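(* Let $0<q<1$, let $a<0$ be real, and let $N\ge 1$ be an integer. Then $$\mathrm{Pf}\left((q^i-q^j)\sum_{k=0}^{i+j-1}\begin{bmatrix} i+j-1\\ k\end{bmatrix}_q a^k\right)_{i,j=0}^{2N-1}=a^{N(N-1)}\,q^{\frac16 N(N-1)(4N-5)}\prod_{k=0}^{N-1}(q;q)_{2k+1}.$$
   Context: $\mathrm{Pf}(A_{i,j})_{i,j=0}^{2N-1}$ denotes the Pfaffian of the $2N\times2N$ skew-symmetric matrix $(A_{i,j})$, normalised so that for $N=1$ it equals $A_{0,1}$; diagonal entries are $0$. For $n\ge 0$, $(x;q)_n=\prod_{l=0}^{n-1}(1-xq^l)$, and $\begin{bmatrix} n\\ k\end{bmatrix}_q=\frac{(q;q)_n}{(q;q)_k(q;q)_{n-k}}$ is the $q$-binomial coefficient. (Up to a constant factor, the sums $\sum_{k=0}^{n}\begin{bmatrix} n\\ k\end{bmatrix}_q a^k$ are the moments of the Al-Salam–Carlitz I weight.) *)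

theory Defs
  imports Complex_Main "HOL-Combinatorics.Permutations"
begin

(* The Pfaffian of the 2N x 2N matrix with entries A i j for i, j < 2N, by the
   Leibniz-type formula; entries of A outside this range do not contribute.
   It is meant for matrices that are skew-symmetric on this range. *)
definition pfaffian :: "nat \<Rightarrow> (nat \<Rightarrow> nat \<Rightarrow> 'a::field_char_0) \<Rightarrow> 'a" where
  "pfaffian N A =
     (\<Sum>p | p permutes {..<2*N}. of_int (sign p) * (\<Prod>l<N. A (p (2*l)) (p (2*l+1))))
       / (2 ^ N * fact N)"

lemma pfaffian_1:
  fixes A :: "nat \<Rightarrow> nat \<Rightarrow> 'a::field_char_0"
  assumes "A 1 0 = - A 0 1"
  shows "pfaffian 1 A = A 0 1"
proof -
  have perms: "{p. p permutes {..<2::nat}} = {id, transpose 0 1}"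
    using permutes_doubleton_iff[of _ "0::nat" 1]
    by (auto simp: numeral_2_eq_2 lessThan_Suc insert_commute)
  have ne: "id \<noteq> transpose (0::nat) 1"
    by (auto simp: fun_eq_iff transpose_def)
  show ?thesis
    unfolding pfaffian_def using assms ne
    by (simp add: perms sign_swap_id sign_id)
qed

definition qpoch :: "'a::comm_ring_1 \<Rightarrow> 'a \<Rightarrow> nat \<Rightarrow> 'a" where
  "qpoch x q n = (\<Prod>l<n. 1 - x * q ^ l)"

(* Intended for k <= n and q not a root of unity, so that no subtraction is truncated
   and no denominator vanishes. *)
definition qbinom :: "'a::field \<Rightarrow> nat \<Rightarrow> nat \<Rightarrow> 'a" where
  "qbinom q n k = qpoch q q n / (qpoch q q k * qpoch q q (n - k))"

end

(*
  Let L be the linear functional on polynomials whose moments are the Rogers-Szego polynomials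
  h_n(a) = \<Sum>_k [n choose k]_q a^k, so that the matrix is the Gram matrix of the monomials for the
  skew form <f, g> = L (f D g - g D f), where D f = (f(x) - f(q x)) / x.  The three-term
  recurrence of h_n says exactly that D has the L-adjoint
    R f = - D F - (x - 1 - a) F / a   with F(x) = f(x/q),
  that is, L (R f g) = L (f D g).  Hence the monic multiples U_n of R^n 1 (the
  Al-Salam-Carlitz I polynomials) are orthogonal, and since R raises the degree by one,
  <U_m, U_n> vanishes unless |m - n| = 1.  The passage from monomials to the U_n is
  unitriangular and so preserves the Pfaffian, which for a skew tridiagonal matrix is the product
  of the <U_{2k}, U_{2k+1}> = (1 - q^{2k+1}) L (U_{2k}^2).
*)

theory Submission
  imports Defs "HOL-Library.FuncSet"
begin

section \<open>Pfaffians under congruence\<close>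

lemma prod_lessThan_double:
  "(\<Prod>m<2*N. g m) = (\<Prod>l<N. g (2*l) * g (2*l+1))" for g :: "nat \<Rightarrow> 'a::comm_monoid_mult"
  by (induction N) (auto simp: algebra_simps)

text \<open>Choosing a pair of indices for each of \<open>N\<close> factors amounts to choosing one
  function on \<open>2*N\<close> points, read off at \<open>2*l\<close> and
  \<open>2*l+1\<close>.\<close>

lemma prod_double_sum_PiE:
  fixes F :: "nat \<Rightarrow> 'b \<Rightarrow> 'b \<Rightarrow> 'a::comm_semiring_1"
  assumes "finite X"
  shows "(\<Prod>l<N. \<Sum>i\<in>X. \<Sum>j\<in>X. F l i j)
    = (\<Sum>f\<in>{..<2*N} \<rightarrow>\<^sub>E X. \<Prod>l<N. F l (f (2*l)) (f (2*l+1)))"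
proof -
  have "(\<Prod>l<N. \<Sum>i\<in>X. \<Sum>j\<in>X. F l i j)
      = (\<Prod>l<N. \<Sum>x\<in>X\<times>X. F l (fst x) (snd x))"
    by (simp add: sum.cartesian_product case_prod_beta)
  also have "\<dots> = (\<Sum>g\<in>{..<N} \<rightarrow>\<^sub>E X\<times>X. \<Prod>l<N. F l (fst (g l)) (snd (g l)))"
    using assms by (intro prod_sum_PiE) auto
  also have "\<dots> = (\<Sum>f\<in>{..<2*N} \<rightarrow>\<^sub>E X. \<Prod>l<N. F l (f (2*l)) (f (2*l+1)))"
  proof (rule sum.reindex_bij_witness
      [where i = "\<lambda>f. \<lambda>l\<in>{..<N}. (f (2*l), f (2*l+1))"
         and j = "\<lambda>g. \<lambda>m\<in>{..<2*N}. if even m then fst (g (m div 2)) else snd (g (m div 2))"],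
      goal_cases)
    case (1 g)
    show ?case
    proof
      fix l
      show "(\<lambda>l\<in>{..<N}. ((\<lambda>m\<in>{..<2*N}. if even m then fst (g (m div 2)) else snd (g (m div 2))) (2*l),
         (\<lambda>m\<in>{..<2*N}. if even m then fst (g (m div 2)) else snd (g (m div 2))) (2*l+1))) l = g l"
        using 1 by (cases "l < N") (auto simp: PiE_def extensional_def)
    qed
  next
    case (2 g)
    then have "g l \<in> X \<times> X" if "l < N" for l
      using that by auto
    then have "g (m div 2) \<in> X \<times> X" if "m < 2*N" for m
      using that by auto
    then show ?case by (intro restrict_PiE_iff[THEN iffD2]) (simp add: mem_Times_iff)
  next
    case (3 f)
    show ?case
    proof
      fix m
      show "(\<lambda>m\<in>{..<2*N}. if even m then fst ((\<lambda>l\<in>{..<N}. (f (2*l), f (2*l+1))) (m div 2))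
         else snd ((\<lambda>l\<in>{..<N}. (f (2*l), f (2*l+1))) (m div 2))) m = f m"
        using 3 by (cases "m < 2*N") (auto simp: PiE_def extensional_def)
    qed
  next
    case (4 f)
    then have "f m \<in> X" if "m < 2*N" for m
      using that by auto
    then show ?case by (intro restrict_PiE_iff[THEN iffD2]) auto
  next
    case (5 g)
    show ?case by (intro prod.cong) auto
  qed
  finally show ?thesis .
qed

text \<open>The sum over \<open>p\<close> is the determinant of the matrix whose \<open>m\<close>-th column is
  column \<open>f m\<close> of \<open>B\<close>.\<close>

lemma leibniz_sum_non_inj:
  fixes B :: "nat \<Rightarrow> 'b \<Rightarrow> 'a::field_char_0"
  assumes "\<not> inj_on f {..<n}"
  shows "(\<Sum>p | p permutes {..<n}. of_int (sign p) * (\<Prod>m<n. B (p m) (f m))) = 0"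
    (is "?S = 0")
proof -
  obtain x y where xy: "x < n" "y < n" "x \<noteq> y" "f x = f y"
    using assms by (auto simp: inj_on_def)
  let ?t = "transpose x y"
  have t: "?t permutes {..<n}"
    using xy by (intro permutes_swap_id) auto
  \<comment> \<open>Replacing \<open>p\<close> by \<open>p \<circ> ?t\<close> permutes the summands;
    as \<open>f\<close> does not distinguish \<open>x\<close> from \<open>y\<close>, the only effect
    is a sign.\<close>
  have "?S = (\<Sum>p | p permutes {..<n}. of_int (sign (p \<circ> ?t)) * (\<Prod>m<n. B ((p \<circ> ?t) m) (f m)))"
    by (rule sum_permutations_compose_right[OF t])
  also have "\<dots> = (\<Sum>p | p permutes {..<n}. - (of_int (sign p) * (\<Prod>m<n. B (p m) (f m))))"
  proof (intro sum.cong refl)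
    fix p assume "p \<in> {p. p permutes {..<n}}"
    then have "permutation p" "permutation ?t"
      using t by (auto intro: permutation_permutes[THEN iffD2] exI[of _ "{..<n}"])
    then have sg: "sign (p \<circ> ?t) = - sign p"
      using xy by (simp add: sign_compose sign_swap_id)
    have "(\<Prod>m<n. B ((p \<circ> ?t) m) (f m)) = (\<Prod>m<n. B ((p \<circ> ?t) (?t m)) (f (?t m)))"
      using prod.permute[OF t, of "\<lambda>m. B ((p \<circ> ?t) m) (f m)"] by (simp add: o_def)
    also have "\<dots> = (\<Prod>m<n. B (p m) (f m))"
      using xy by (intro prod.cong) (auto simp: transpose_def)
    finally show "of_int (sign (p \<circ> ?t)) * (\<Prod>m<n. B ((p \<circ> ?t) m) (f m))
      = - (of_int (sign p) * (\<Prod>m<n. B (p m) (f m)))"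
      by (simp add: sg)
  qed
  finally have "?S = - ?S" by (simp add: sum_negf)
  then show ?thesis by simp
qed

text \<open>Substituting \<open>p \<circ> f\<close> for \<open>p\<close> aligns rows with the
  permuted columns and releases the sign of \<open>f\<close>.\<close>

lemma leibniz_sum_permutes:
  fixes B :: "nat \<Rightarrow> nat \<Rightarrow> 'a::field_char_0"
  assumes f: "f permutes {..<n}"
  shows "(\<Sum>p | p permutes {..<n}. of_int (sign p) * (\<Prod>m<n. B (p m) (f m)))
    = of_int (sign f) * (\<Sum>p | p permutes {..<n}. of_int (sign p) * (\<Prod>m<n. B (p m) m))"
proof -
  have "(\<Sum>p | p permutes {..<n}. of_int (sign p) * (\<Prod>m<n. B (p m) (f m)))
    = (\<Sum>p | p permutes {..<n}. of_int (sign (p \<circ> f)) * (\<Prod>m<n. B ((p \<circ> f) m) (f m)))"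
    by (rule sum_permutations_compose_right[OF f])
  also have "\<dots> = (\<Sum>p | p permutes {..<n}. of_int (sign f) * (of_int (sign p) * (\<Prod>m<n. B (p m) m)))"
  proof (intro sum.cong refl)
    fix p assume "p \<in> {p. p permutes {..<n}}"
    then have "permutation p" "permutation f"
      using f by (auto intro: permutation_permutes[THEN iffD2] exI[of _ "{..<n}"])
    moreover have "(\<Prod>m<n. B (p m) m) = (\<Prod>m<n. B (p (f m)) (f m))"
      using prod.permute[OF f, of "\<lambda>m. B (p m) m"] by (simp add: o_def)
    ultimately show "of_int (sign (p \<circ> f)) * (\<Prod>m<n. B ((p \<circ> f) m) (f m))
      = of_int (sign f) * (of_int (sign p) * (\<Prod>m<n. B (p m) m))"
      by (simp add: sign_compose)
  qed
  finally show ?thesis by (simp add: sum_distrib_left)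
qed

text \<open>Only the identity survives: any other permutation sends some \<open>m\<close> to a
  smaller index, where \<open>B\<close> vanishes.\<close>

lemma leibniz_sum_lower_unitriangular:
  fixes B :: "nat \<Rightarrow> nat \<Rightarrow> 'a::field_char_0"
  assumes "\<And>i. B i i = 1" and tri: "\<And>i k. i < k \<Longrightarrow> B i k = 0"
  shows "(\<Sum>p | p permutes {..<n}. of_int (sign p) * (\<Prod>m<n. B (p m) m)) = 1"
proof -
  have "(\<Sum>p | p permutes {..<n}. of_int (sign p) * (\<Prod>m<n. B (p m) m))
    = (\<Sum>p\<in>{id}. of_int (sign p) * (\<Prod>m<n. B (p m) m))"
  proof (intro sum.mono_neutral_right)
    show "\<forall>p\<in>{p. p permutes {..<n}} - {id}. of_int (sign p) * (\<Prod>m<n. B (p m) m) = 0"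
    proof
      fix p assume "p \<in> {p. p permutes {..<n}} - {id}"
      then have "\<not> (\<forall>m\<in>{..<n}. m \<le> p m)"
        using permutes_natset_ge[of p "{..<n}"] by blast
      then obtain m where "m < n" "p m < m"
        by (auto simp: not_le)
      then have "(\<Prod>m<n. B (p m) m) = 0"
        using tri by auto
      then show "of_int (sign p) * (\<Prod>m<n. B (p m) m) = 0" by simp
    qed
  qed (auto simp: finite_permutations permutes_id)
  also have "\<dots> = 1"
    using assms(1) by (simp add: sign_id)
  finally show ?thesis .
qed

text \<open>Expanding products yields functions that are \<open>undefined\<close> outside
  \<open>S\<close>, while permutations are the identity there; this bridges the two
  conventions.\<close>

lemma bij_betw_restrict_permutes:
  "bij_betw (\<lambda>p. restrict p S) {p. p permutes S} {f \<in> S \<rightarrow>\<^sub>E S. inj_on f S}"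
  if "finite S" for S :: "'a set"
proof (intro bij_betw_byWitness[where f' = "\<lambda>f x. if x \<in> S then f x else x"])
  show "\<forall>p\<in>{p. p permutes S}. (\<lambda>x. if x \<in> S then restrict p S x else x) = p"
    by (auto simp: fun_eq_iff permutes_def)
  show "\<forall>f\<in>{f \<in> S \<rightarrow>\<^sub>E S. inj_on f S}. restrict (\<lambda>x. if x \<in> S then f x else x) S = f"
    by (auto simp: fun_eq_iff PiE_def extensional_def)
  show "(\<lambda>p. restrict p S) ` {p. p permutes S} \<subseteq> {f \<in> S \<rightarrow>\<^sub>E S. inj_on f S}"
    by (auto simp: permutes_in_image inj_on_restrict_eq permutes_inj_on)
  show "(\<lambda>f x. if x \<in> S then f x else x) ` {f \<in> S \<rightarrow>\<^sub>E S. inj_on f S} \<subseteq> {p. p permutes S}"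
  proof clarify
    fix f assume f: "f \<in> S \<rightarrow>\<^sub>E S" "inj_on f S"
    then have "f ` S = S"
      using that by (intro endo_inj_surj) auto
    then have "bij_betw f S S"
      using f by (simp add: bij_betw_def)
    then have "bij_betw (\<lambda>x. if x \<in> S then f x else x) S S"
      using bij_betw_cong[of S f "\<lambda>x. if x \<in> S then f x else x" S] by simp
    then show "(\<lambda>x. if x \<in> S then f x else x) permutes S"
      by (intro bij_imp_permutes) auto
  qed
qed

text \<open>Proved like the multiplicativity of determinants: expand every product, sum over
  \<open>p\<close> first, and recognise determinants of column selections of
  \<open>B\<close>.\<close>

lemma pfaffian_congruence:
  fixes A B :: "nat \<Rightarrow> nat \<Rightarrow> 'a::field_char_0"
  shows "pfaffian N (\<lambda>i j. \<Sum>k<2*N. \<Sum>l<2*N. B i k * A k l * B j l)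
    = (\<Sum>p | p permutes {..<2*N}. of_int (sign p) * (\<Prod>m<2*N. B (p m) m)) * pfaffian N A"
proof -
  let ?S = "{..<2*N}"
  let ?P = "{p. p permutes ?S}"
  let ?D = "\<lambda>f. \<Sum>p\<in>?P. of_int (sign p) * (\<Prod>m<2*N. B (p m) (f m))"
  let ?A = "\<lambda>f. \<Prod>l<N. A (f (2*l)) (f (2*l+1))"
  have "(\<Sum>p\<in>?P. of_int (sign p) *
        (\<Prod>l<N. \<Sum>k<2*N. \<Sum>k'<2*N. B (p (2*l)) k * A k k' * B (p (2*l+1)) k'))
    = (\<Sum>p\<in>?P. of_int (sign p) * (\<Sum>f\<in>?S \<rightarrow>\<^sub>E ?S.
          (\<Prod>m<2*N. B (p m) (f m)) * ?A f))"
  proof (intro sum.cong refl arg_cong2[where f = "(*)"])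
    fix p
    have "(\<Prod>l<N. \<Sum>k<2*N. \<Sum>k'<2*N. B (p (2*l)) k * A k k' * B (p (2*l+1)) k')
      = (\<Sum>f\<in>?S \<rightarrow>\<^sub>E ?S. \<Prod>l<N. B (p (2*l)) (f (2*l)) * A (f (2*l)) (f (2*l+1))
          * B (p (2*l+1)) (f (2*l+1)))"
      by (rule prod_double_sum_PiE) simp
    then show "(\<Prod>l<N. \<Sum>k<2*N. \<Sum>k'<2*N. B (p (2*l)) k * A k k' * B (p (2*l+1)) k')
      = (\<Sum>f\<in>?S \<rightarrow>\<^sub>E ?S. (\<Prod>m<2*N. B (p m) (f m)) * ?A f)"
      unfolding prod_lessThan_double by (simp add: prod.distrib mult_ac)
  qed
  also have "\<dots> = (\<Sum>f\<in>?S \<rightarrow>\<^sub>E ?S. ?A f * ?D f)"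
    unfolding sum_distrib_left
    by (subst sum.swap) (intro sum.cong refl, simp only: mult_ac)
  \<comment> \<open>Selections with a repeated column contribute nothing, so only the permutations
    of \<open>?S\<close> remain.\<close>
  also have "\<dots> = (\<Sum>f\<in>{f \<in> ?S \<rightarrow>\<^sub>E ?S. inj_on f ?S}. ?A f * ?D f)"
    by (intro sum.mono_neutral_right) (auto simp: leibniz_sum_non_inj finite_PiE)
  also have "\<dots> = (\<Sum>f\<in>?P. ?A (restrict f ?S) * ?D (restrict f ?S))"
    by (rule sum.reindex_bij_betw[OF bij_betw_restrict_permutes, symmetric]) simp
  also have "\<dots> = (\<Sum>f\<in>?P. of_int (sign f) * ?A f * ?D id)"
  proof (intro sum.cong refl)
    fix f assume "f \<in> ?P"
    then have "?D f = of_int (sign f) * ?D id"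
      using leibniz_sum_permutes[of f "2*N" B] by simp
    moreover have "?D (restrict f ?S) = ?D f"
      by simp
    moreover have "?A (restrict f ?S) = ?A f"
      by (intro prod.cong) auto
    ultimately show "?A (restrict f ?S) * ?D (restrict f ?S) = of_int (sign f) * ?A f * ?D id"
      by (simp only: mult_ac)
  qed
  also have "\<dots> = ?D id * (\<Sum>f\<in>?P. of_int (sign f) * ?A f)"
    by (simp add: sum_distrib_left mult_ac)
  finally show ?thesis
    unfolding pfaffian_def by simp
qed

section \<open>Pfaffians of skew tridiagonal matrices\<close>

definition pf_term :: "nat \<Rightarrow> (nat \<Rightarrow> nat \<Rightarrow> 'a::field_char_0) \<Rightarrow> (nat \<Rightarrow> nat) \<Rightarrow> 'a" where
  "pf_term N A p = of_int (sign p) * (\<Prod>l<N. A (p (2*l)) (p (2*l+1)))"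

text \<open>Two signs cancel: that of the transposition and that of the skew entry in factor
  \<open>l\<close>.\<close>

lemma pf_term_swap_within_pair:
  fixes A :: "nat \<Rightarrow> nat \<Rightarrow> 'a::field_char_0"
  assumes skew: "\<And>i j. A j i = - A i j" and p: "permutation p" and l: "l < N"
  shows "pf_term N A (p \<circ> transpose (2*l) (2*l+1)) = pf_term N A p"
proof -
  let ?t = "transpose (2*l) (2*l+1)"
  have "(\<Prod>k<N. A ((p \<circ> ?t) (2*k)) ((p \<circ> ?t) (2*k+1)))
      = (\<Prod>k<N. (if k = l then - 1 else 1) * A (p (2*k)) (p (2*k+1)))"
  proof (intro prod.cong refl)
    fix k
    have "?t (2*k) = 2*k \<and> ?t (2*k+1) = 2*k+1" if "k \<noteq> l"
      using that by (auto simp: transpose_def)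
    then show "A ((p \<circ> ?t) (2*k)) ((p \<circ> ?t) (2*k+1))
      = (if k = l then - 1 else 1) * A (p (2*k)) (p (2*k+1))"
      using skew[of "p (2*l)" "p (2*l+1)"] by auto
  qed
  also have "\<dots> = - (\<Prod>k<N. A (p (2*k)) (p (2*k+1)))"
    using l by (simp add: prod.distrib prod.delta)
  finally show ?thesis
    using p by (simp add: pf_term_def sign_compose sign_swap_id permutation_swap_id)
qed

text \<open>Two disjoint transpositions form an even permutation, and moving whole pairs merely
  reorders the factors.\<close>

lemma pf_term_swap_pairs:
  fixes A :: "nat \<Rightarrow> nat \<Rightarrow> 'a::field_char_0"
  assumes p: "permutation p" and lk: "l < N" "k < N" "l \<noteq> k"
  shows "pf_term N A (p \<circ> (transpose (2*l) (2*k) \<circ> transpose (2*l+1) (2*k+1))) = pf_term N A p"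
proof -
  let ?t = "transpose (2*l) (2*k) \<circ> transpose (2*l+1) (2*k+1)"
  let ?s = "transpose l k"
  have s: "?s permutes {..<N}"
    using lk by (intro permutes_swap_id) auto
  have "?t (2*m) = 2 * ?s m \<and> ?t (2*m+1) = 2 * ?s m + 1" for m
    by (auto simp: transpose_def)
  then have "(\<Prod>m<N. A ((p \<circ> ?t) (2*m)) ((p \<circ> ?t) (2*m+1)))
      = (\<Prod>m<N. A (p (2 * ?s m)) (p (2 * ?s m + 1)))"
    by (metis comp_apply)
  also have "\<dots> = (\<Prod>m<N. A (p (2*m)) (p (2*m+1)))"
    using prod.permute[OF s, of "\<lambda>m. A (p (2*m)) (p (2*m+1))"] by (simp add: o_def)
  finally show ?thesis
    using p lk by (simp add: pf_term_def sign_compose sign_swap_id permutation_swap_id permutation_compose)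
qed

text \<open>The symmetries of a Pfaffian term act transitively on positions, so that the position of the last
  index can be normalised to the last one in the expansion below.\<close>

lemma pf_term_symmetry_transitive:
  fixes A :: "nat \<Rightarrow> nat \<Rightarrow> 'a::field_char_0"
  assumes skew: "\<And>i j. A j i = - A i j" and m: "m < 2 * Suc N"
  obtains t where "t permutes {..<2 * Suc N}" "t m = 2*N+1"
    "\<And>p. permutation p \<Longrightarrow> pf_term (Suc N) A (p \<circ> t) = pf_term (Suc N) A p"
proof -
  \<comment> \<open>Odd positions are reached by swapping whole pairs; an even position is first
    made odd by a swap within its pair.\<close>
  have odd: "\<exists>t. t permutes {..<2 * Suc N} \<and> t (2*l+1) = 2*N+1 \<and>
      (\<forall>p. permutation p \<longrightarrow> pf_term (Suc N) A (p \<circ> t) = pf_term (Suc N) A p)"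
    if l: "l < Suc N" for l
  proof (cases "l = N")
    case True
    then show ?thesis by (intro exI[of _ id]) (simp add: permutes_id)
  next
    case False
    let ?t = "transpose (2*l) (2*N) \<circ> transpose (2*l+1) (2*N+1)"
    have "?t permutes {..<2 * Suc N}"
      using l by (intro permutes_compose permutes_swap_id) auto
    moreover have "?t (2*l+1) = 2*N+1"
      by (simp add: transpose_def)
    ultimately show ?thesis
      using pf_term_swap_pairs[of _ l "Suc N" N A] l False
      by (intro exI[of _ ?t]) auto
  qed
  have "m div 2 < Suc N" using m by auto
  from odd[OF this] obtain t where t: "t permutes {..<2 * Suc N}" "t (2*(m div 2)+1) = 2*N+1"
    "\<And>p. permutation p \<Longrightarrow> pf_term (Suc N) A (p \<circ> t) = pf_term (Suc N) A p"
    by blast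
  show thesis
  proof (cases "even m")
    case False
    then have "2*(m div 2)+1 = m" by presburger
    with t show ?thesis using that[of t] by simp
  next
    case True
    then have m2: "2*(m div 2) = m" and m1: "m + 1 < 2 * Suc N"
      using m by presburger+
    let ?s = "transpose m (m+1)"
    show ?thesis
    proof (rule that[of "t \<circ> ?s"])
      show "t \<circ> ?s permutes {..<2 * Suc N}"
        using t(1) m m1 by (intro permutes_compose permutes_swap_id) auto
      show "(t \<circ> ?s) m = 2*N+1"
        using t(2) m2 by simp
      fix p :: "nat \<Rightarrow> nat" assume p: "permutation p"
      moreover have "permutation t"
        using t(1) by (auto intro: permutation_permutes[THEN iffD2] exI[of _ "{..<2 * Suc N}"])
      ultimately show "pf_term (Suc N) A (p \<circ> (t \<circ> ?s)) = pf_term (Suc N) A p"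
        using pf_term_swap_within_pair[of A "p \<circ> t" "m div 2" "Suc N", OF skew] t(3)[OF p] m2 m
        by (simp add: o_assoc permutation_compose)
    qed
  qed
qed

text \<open>The index \<open>2*N+1\<close> occupies one of \<open>2*N+2\<close> positions, all
  contributing equally by symmetry. Once it is in the last position, the vanishing entries force its
  partner to be \<open>2*N\<close>.\<close>

lemma pfaffian_Suc_last_column:
  fixes A :: "nat \<Rightarrow> nat \<Rightarrow> 'a::field_char_0"
  assumes skew: "\<And>i j. A j i = - A i j" and zero: "\<And>i. i < 2*N \<Longrightarrow> A i (2*N+1) = 0"
  shows "pfaffian (Suc N) A = A (2*N) (2*N+1) * pfaffian N A"
proof -
  let ?S = "{..<2 * Suc N}"
  let ?P = "{p. p permutes ?S}"
  let ?w = "pf_term (Suc N) A"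
  let ?top = "2*N+1"
  have finP: "finite ?P" by (simp add: finite_permutations)
  have "(\<Sum>p\<in>?P. ?w p) = (\<Sum>p\<in>?P. \<Sum>m\<in>?S. if p m = ?top then ?w p else 0)"
  proof (intro sum.cong refl)
    fix p assume "p \<in> ?P"
    then have "p permutes ?S" by simp
    then have "p m = ?top \<longleftrightarrow> m = inv p ?top" for m
      using permutes_inverses by metis
    moreover have "inv p ?top \<in> ?S"
      using permutes_in_image[OF permutes_inv[OF \<open>p permutes ?S\<close>]] by auto
    ultimately show "?w p = (\<Sum>m\<in>?S. if p m = ?top then ?w p else 0)"
      by simp
  qed
  also have "\<dots> = (\<Sum>m\<in>?S. \<Sum>p\<in>?P. if p m = ?top then ?w p else 0)"
    by (rule sum.swap)
  also have "\<dots> = (\<Sum>m\<in>?S. \<Sum>p\<in>?P. if p ?top = ?top then ?w p else 0)"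
  proof (rule sum.cong[OF refl])
    fix m assume "m \<in> ?S"
    then have m: "m < 2 * Suc N" by simp
    obtain t where t: "t permutes ?S" "t m = ?top"
      "\<And>p. permutation p \<Longrightarrow> ?w (p \<circ> t) = ?w p"
      using pf_term_symmetry_transitive[where A = A, OF skew m] by blast
    have "(\<Sum>p\<in>?P. if p m = ?top then ?w p else 0)
        = (\<Sum>p\<in>?P. if (p \<circ> t) m = ?top then ?w (p \<circ> t) else 0)"
      by (rule sum_permutations_compose_right[OF t(1)])
    also have "\<dots> = (\<Sum>p\<in>?P. if p ?top = ?top then ?w p else 0)"
    proof (intro sum.cong refl)
      fix p assume "p \<in> ?P"
      then have "permutation p"
        by (auto intro: permutation_permutes[THEN iffD2] exI[of _ ?S])
      then show "(if (p \<circ> t) m = ?top then ?w (p \<circ> t) else 0) = (if p ?top = ?top then ?w p else 0)"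
        using t(2,3) by simp
    qed
    finally show "(\<Sum>p\<in>?P. if p m = ?top then ?w p else 0)
        = (\<Sum>p\<in>?P. if p ?top = ?top then ?w p else 0)" .
  qed
  \<comment> \<open>The summand no longer depends on \<open>m\<close>. The resulting factor is the
    ratio of the normalising constants for \<open>Suc N\<close> and \<open>N\<close>.\<close>
  also have "\<dots> = 2 * of_nat (Suc N) * (\<Sum>p\<in>?P. if p ?top = ?top then ?w p else 0)"
    by simp
  also have "(\<Sum>p\<in>?P. if p ?top = ?top then ?w p else 0)
      = (\<Sum>p | p permutes {..<2*N}. if p ?top = ?top then ?w p else 0)"
  proof (intro sum.mono_neutral_right finP ballI)
    show "{p. p permutes {..<2*N}} \<subseteq> ?P"
      by (auto intro: permutes_subset)
    fix p assume p: "p \<in> ?P - {p. p permutes {..<2*N}}"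
    show "(if p ?top = ?top then ?w p else 0) = 0"
    proof (cases "p ?top = ?top")
      case True
      \<comment> \<open>Fixing both \<open>2*N\<close> and \<open>?top\<close> would make
        \<open>p\<close> a permutation of the smaller range. So the partner of \<open>?top\<close>
        lies below \<open>2*N\<close> and gives a zero factor.\<close>
      have "p (2*N) \<noteq> 2*N"
      proof
        assume fix_penultimate: "p (2*N) = 2*N"
        have "p permutes {..<2*N}"
        proof (rule permutes_superset)
          show "p permutes ?S" using p by simp
          fix x assume "x \<in> ?S - {..<2*N}"
          then have "x = 2*N \<or> x = ?top" by auto
          then show "p x = x" using True fix_penultimate by blast
        qed
        then show False using p by simp
      qed
      moreover have "p (2*N) \<in> ?S"
        using p permutes_in_image[of p ?S "2*N"] by simp
      moreover have "p (2*N) \<noteq> ?top"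
      proof
        assume "p (2*N) = ?top"
        then have "p (2*N) = p ?top" using True by simp
        then show False using p permutes_inj[of p ?S] by (simp add: inj_eq)
      qed
      ultimately have "p (2*N) < 2*N" by auto
      then show ?thesis using True zero by (simp add: pf_term_def)
    qed simp
  qed
  also have "\<dots> = (\<Sum>p | p permutes {..<2*N}. pf_term N A p * A (2*N) ?top)"
    by (intro sum.cong refl) (auto simp: pf_term_def permutes_not_in)
  finally have "(\<Sum>p\<in>?P. ?w p)
      = 2 * of_nat (Suc N) * ((\<Sum>p | p permutes {..<2*N}. pf_term N A p) * A (2*N) ?top)"
    by (simp only: sum_distrib_right)
  moreover have "(of_nat (Suc N) :: 'a) \<noteq> 0" by (simp del: of_nat_Suc)
  ultimately show ?thesis
    by (simp add: pfaffian_def pf_term_def field_simps del: of_nat_Suc)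
qed

lemma pfaffian_skew_tridiagonal:
  fixes A :: "nat \<Rightarrow> nat \<Rightarrow> 'a::field_char_0"
  assumes "\<And>i j. A j i = - A i j" and "\<And>i j. i + 1 < j \<Longrightarrow> A i j = 0"
  shows "pfaffian N A = (\<Prod>k<N. A (2*k) (2*k+1))"
proof (induction N)
  case 0
  show ?case by (simp add: pfaffian_def sign_id)
next
  case (Suc N)
  have "pfaffian (Suc N) A = A (2*N) (2*N+1) * pfaffian N A"
    by (rule pfaffian_Suc_last_column[OF assms(1)]) (simp add: assms(2))
  then show ?case
    by (simp add: Suc.IH mult.commute)
qed

section \<open>Rogers-Szego and Al-Salam-Carlitz polynomials\<close>

lemma qpoch_Suc: "qpoch x q (Suc n) = qpoch x q n * (1 - x * q ^ n)"
  by (simp add: qpoch_def)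

lemma qpoch_q_nonzero:
  fixes q :: "'a::field"
  assumes "\<And>n. n > 0 \<Longrightarrow> q ^ n \<noteq> 1"
  shows "qpoch q q n \<noteq> 0"
  using assms[of "Suc _"] by (auto simp: qpoch_def)

definition rogers_szego :: "'a::field \<Rightarrow> 'a \<Rightarrow> nat \<Rightarrow> 'a" where
  "rogers_szego q a n = (\<Sum>k=0..n. qbinom q n k * a ^ k)"

lemma rogers_szego_0 [simp]: "rogers_szego q a 0 = 1"
  by (simp add: rogers_szego_def qbinom_def qpoch_def)

context
  fixes q a :: "'a::field"
  assumes q_not_root: "\<And>n. n > 0 \<Longrightarrow> q ^ n \<noteq> 1"
begin

lemma qbinom_0 [simp]: "qbinom q n 0 = 1"
  and qbinom_self [simp]: "qbinom q n n = 1"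
  using qpoch_q_nonzero[OF q_not_root] by (simp_all add: qbinom_def qpoch_def)

text \<open>A Pascal rule of order two, shaped so that summing it against powers of \<open>a\<close>
  gives the three-term recurrence.\<close>

lemma qbinom_Suc_Suc_Suc:
  assumes "k \<le> n"
  shows "qbinom q (Suc (Suc n)) (Suc k)
    = qbinom q (Suc n) (Suc k) + qbinom q (Suc n) k - (1 - q ^ Suc n) * qbinom q n k"
proof -
  obtain d where n: "n = k + d" using assms le_Suc_ex by blast
  have nz: "qpoch q q m \<noteq> 0" "1 - q * q ^ m \<noteq> 0" for m
    using qpoch_q_nonzero[OF q_not_root] q_not_root[of "Suc m"] by auto
  have d: "Suc (Suc n) - Suc k = Suc d" "Suc n - Suc k = d" "Suc n - k = Suc d" "n - k = d"
    by (simp_all add: n)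
  \<comment> \<open>In terms of \<open>q ^ k\<close> and \<open>q ^ d\<close>, the claim becomes a
    polynomial identity once denominators are cleared.\<close>
  define x y where "x = q ^ k" and "y = q ^ d"
  have nz': "1 - q * x \<noteq> 0" "1 - q * y \<noteq> 0"
    using nz(2) by (simp_all add: x_def y_def)
  have pw: "q ^ n = x * y" "q ^ k = x" "q ^ d = y"
    by (simp_all add: n x_def y_def power_add)
  show ?thesis
    unfolding qbinom_def d qpoch_Suc power_Suc pw
    using nz' nz(1)[of k] nz(1)[of d]
    by (simp add: divide_simps) algebra
qed

lemma rogers_szego_recurrence:
  "rogers_szego q a (Suc n)
    = (1 + a) * rogers_szego q a n - a * (1 - q ^ n) * rogers_szego q a (n - 1)"
proof (cases n)
  case 0
  show ?thesis by (simp add: 0 rogers_szego_def)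
next
  case (Suc m)
  let ?h = "rogers_szego q a"
  have shift: "?h (Suc j) = 1 + (\<Sum>k\<le>j. qbinom q (Suc j) (Suc k) * a ^ Suc k)" for j
    unfolding rogers_szego_def atLeast0AtMost by (subst sum.atMost_Suc_shift) simp
  \<comment> \<open>Splitting off both end terms leaves exactly the range in which the Pascal rule
    applies.\<close>
  have "?h (Suc (Suc m)) = 1 + a ^ Suc (Suc m)
      + (\<Sum>k\<le>m. qbinom q (Suc (Suc m)) (Suc k) * a ^ Suc k)"
    by (subst shift) simp
  also have "(\<Sum>k\<le>m. qbinom q (Suc (Suc m)) (Suc k) * a ^ Suc k)
    = (\<Sum>k\<le>m. qbinom q (Suc m) (Suc k) * a ^ Suc k)
      + a * (\<Sum>k\<le>m. qbinom q (Suc m) k * a ^ k)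
      - a * (1 - q ^ Suc m) * (\<Sum>k\<le>m. qbinom q m k * a ^ k)"
    unfolding sum_distrib_left sum.distrib[symmetric] sum_subtractf[symmetric]
    by (intro sum.cong refl) (simp add: qbinom_Suc_Suc_Suc algebra_simps)
  also have "(\<Sum>k\<le>m. qbinom q (Suc m) (Suc k) * a ^ Suc k) = ?h (Suc m) - 1"
    by (simp add: shift)
  also have "(\<Sum>k\<le>m. qbinom q (Suc m) k * a ^ k) = ?h (Suc m) - a ^ Suc m"
    by (simp add: rogers_szego_def atLeast0AtMost)
  also have "(\<Sum>k\<le>m. qbinom q m k * a ^ k) = ?h m"
    by (simp add: rogers_szego_def atLeast0AtMost)
  finally show ?thesis
    by (simp add: Suc algebra_simps)
qed

end

section \<open>Al-Salam-Carlitz polynomials and their orthogonality\<close>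

text \<open>\<open>asc_coeff q a n k\<close> is the coefficient of \<open>x^k\<close> in the monic Al-Salam-Carlitz polynomial
  \<open>U_n\<close>, generated by \<open>U_{n+1} = - a q^n R U_n\<close>; \<open>asc_moment q a n m\<close> is \<open>L (U_n x^m)\<close>.\<close>

fun asc_coeff :: "'a::field \<Rightarrow> 'a \<Rightarrow> nat \<Rightarrow> nat \<Rightarrow> 'a" where
  "asc_coeff q a 0 k = (if k = 0 then 1 else 0)"
| "asc_coeff q a (Suc n) k =
     a * q ^ n * (1 - q ^ Suc k) / q ^ Suc k * asc_coeff q a n (Suc k)
     + (if k = 0 then 0 else q ^ n / q ^ (k - 1) * asc_coeff q a n (k - 1))
     - (1 + a) * q ^ n / q ^ k * asc_coeff q a n k"

lemma asc_coeff_above: "n < k \<Longrightarrow> asc_coeff q a n k = 0"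
  by (induction n arbitrary: k) auto

lemma asc_coeff_diag: "q \<noteq> 0 \<Longrightarrow> asc_coeff q a n n = 1"
  by (induction n) (auto simp: asc_coeff_above)

definition asc_moment :: "'a::field \<Rightarrow> 'a \<Rightarrow> nat \<Rightarrow> nat \<Rightarrow> 'a" where
  "asc_moment q a n m = (\<Sum>k\<le>n. asc_coeff q a n k * rogers_szego q a (k + m))"

lemma asc_moment_lessThan:
  assumes "n < M"
  shows "asc_moment q a n m = (\<Sum>k<M. asc_coeff q a n k * rogers_szego q a (k + m))"
  unfolding asc_moment_def using assms
  by (intro sum.mono_neutral_left) (auto simp: asc_coeff_above)

context
  fixes q a :: "'a::field"
  assumes q_not_root: "\<And>n. n > 0 \<Longrightarrow> q ^ n \<noteq> 1"
    and q_nonzero: "q \<noteq> 0"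
begin

text \<open>The adjointness \<open>L (R U_n x^m) = L (U_n D x^m)\<close>.  For \<open>m = 0\<close> the truncated \<open>m - 1\<close> is
  harmless because the factor \<open>1 - q ^ m\<close> vanishes; the same applies to all such subtractions below.\<close>

lemma asc_moment_Suc:
  "asc_moment q a (Suc n) m = - a * q ^ n * (1 - q ^ m) * asc_moment q a n (m - 1)"
proof -
  let ?h = "rogers_szego q a"
  let ?c = "asc_coeff q a n"
  \<comment> \<open>The three terms of the recursion are reindexed by the degree \<open>i\<close> in
    \<open>U_n\<close>. The added term \<open>i = 0\<close> vanishes through its factor
    \<open>1 - q ^ i\<close>.\<close>
  have low: "(\<Sum>k\<le>Suc n. a * q ^ n * (1 - q ^ Suc k) / q ^ Suc k * ?c (Suc k) * ?h (k + m))
    = (\<Sum>i\<le>n. a * q ^ n * (1 - q ^ i) / q ^ i * ?c i * ?h (i - 1 + m))"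
  proof -
    have "(\<Sum>k\<le>Suc n. a * q ^ n * (1 - q ^ Suc k) / q ^ Suc k * ?c (Suc k) * ?h (k + m))
      = (\<Sum>i\<le>Suc (Suc n). a * q ^ n * (1 - q ^ i) / q ^ i * ?c i * ?h (i - 1 + m))"
      by (subst sum.atMost_Suc_shift[of _ "Suc n"]) simp
    then show ?thesis by (simp add: asc_coeff_above)
  qed
  have up: "(\<Sum>k\<le>Suc n. (if k = 0 then 0 else q ^ n / q ^ (k - 1) * ?c (k - 1)) * ?h (k + m))
    = (\<Sum>i\<le>n. q ^ n / q ^ i * ?c i * ?h (Suc i + m))"
    by (subst sum.atMost_Suc_shift) simp
  have same: "(\<Sum>k\<le>Suc n. (1 + a) * q ^ n / q ^ k * ?c k * ?h (k + m))
    = (\<Sum>i\<le>n. (1 + a) * q ^ n / q ^ i * ?c i * ?h (i + m))"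
    by (simp add: asc_coeff_above)
  have "asc_moment q a (Suc n) m
    = (\<Sum>k\<le>Suc n. a * q ^ n * (1 - q ^ Suc k) / q ^ Suc k * ?c (Suc k) * ?h (k + m))
      + (\<Sum>k\<le>Suc n. (if k = 0 then 0 else q ^ n / q ^ (k - 1) * ?c (k - 1)) * ?h (k + m))
      - (\<Sum>k\<le>Suc n. (1 + a) * q ^ n / q ^ k * ?c k * ?h (k + m))"
    unfolding asc_moment_def asc_coeff.simps(2) sum.distrib[symmetric] sum_subtractf[symmetric]
    by (intro sum.cong refl) (simp only: distrib_right left_diff_distrib)
  also have "\<dots> = (\<Sum>i\<le>n. - a * q ^ n * (1 - q ^ m) * (?c i * ?h (i + (m - 1))))"
    unfolding low up same sum.distrib[symmetric] sum_subtractf[symmetric]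
  proof (intro sum.cong refl)
    fix i
    have rec: "?h (Suc i + m) = (1 + a) * ?h (i + m) - a * (1 - q ^ (i + m)) * ?h (i + m - 1)"
      using rogers_szego_recurrence[OF q_not_root, of a "i + m"] by simp
    have e1: "(1 - q ^ i) * ?h (i - 1 + m) = (1 - q ^ i) * ?h (i + m - 1)"
      by (cases i) auto
    have e2: "(1 - q ^ m) * ?h (i + (m - 1)) = (1 - q ^ m) * ?h (i + m - 1)"
      by (cases m) auto
    have "a * q ^ n * (1 - q ^ i) / q ^ i * ?c i * ?h (i - 1 + m)
        + q ^ n / q ^ i * ?c i * ?h (Suc i + m) - (1 + a) * q ^ n / q ^ i * ?c i * ?h (i + m)
      = q ^ n / q ^ i * ?c i * (a * ((1 - q ^ i) * ?h (i - 1 + m))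
          + ?h (Suc i + m) - (1 + a) * ?h (i + m))"
      by (simp add: algebra_simps add_divide_distrib diff_divide_distrib)
    \<comment> \<open>The recurrence leaves \<open>(1 - q ^ i) - (1 - q ^ (i + m))\<close>, which is
      \<open>- q ^ i * (1 - q ^ m)\<close>.\<close>
    also have "\<dots> = q ^ n / q ^ i * ?c i * (- a * q ^ i * ((1 - q ^ m) * ?h (i + m - 1)))"
      unfolding e1 rec by (simp add: algebra_simps power_add)
    also have "\<dots> = - a * q ^ n * (1 - q ^ m) * (?c i * ?h (i + (m - 1)))"
      unfolding e2[symmetric] using q_nonzero by simp
    finally show "a * q ^ n * (1 - q ^ i) / q ^ i * ?c i * ?h (i - 1 + m)
        + q ^ n / q ^ i * ?c i * ?h (Suc i + m) - (1 + a) * q ^ n / q ^ i * ?c i * ?h (i + m)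
      = - a * q ^ n * (1 - q ^ m) * (?c i * ?h (i + (m - 1)))" .
  qed
  finally show ?thesis
    by (simp add: asc_moment_def sum_distrib_left)
qed

text \<open>Each adjointness step lowers \<open>n\<close> and \<open>m\<close> together, until
  \<open>m = 0\<close> makes the factor \<open>1 - q ^ m\<close> vanish. This is the orthogonality
  of \<open>U_n\<close> to lower degrees.\<close>

lemma asc_moment_below: "m < n \<Longrightarrow> asc_moment q a n m = 0"
proof (induction n arbitrary: m)
  case (Suc n)
  then show ?case by (cases m) (auto simp: asc_moment_Suc)
qed simp

text \<open>Passing from \<open>n\<close> to \<open>Suc n\<close> contributes
  \<open>- a * q ^ n * (1 - q ^ Suc n)\<close>. As \<open>U_n\<close> is monic and orthogonal to
  lower degrees, the value is \<open>L (U_n^2)\<close>.\<close>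

lemma asc_moment_diag: "asc_moment q a n n = (- a) ^ n * q ^ (n * (n - 1) div 2) * qpoch q q n"
proof (induction n)
  case 0
  show ?case by (simp add: asc_moment_def qpoch_def)
next
  case (Suc n)
  have "Suc n * (Suc n - 1) div 2 = n + n * (n - 1) div 2"
    by (cases n) auto
  then show ?case
    using Suc.IH by (simp add: asc_moment_Suc qpoch_Suc power_add algebra_simps)
qed

section \<open>The skew form on the orthogonal basis\<close>

text \<open>The same adjointness with the roles exchanged: \<open>L (x^k D U_n) = L (U_n R x^k)\<close>.\<close>

lemma asc_lowering_adjoint:
  assumes "n < M" and "a \<noteq> 0"
  shows "(\<Sum>l<M. asc_coeff q a n l * ((1 - q ^ l) * rogers_szego q a (k + l - 1)))
    = (- (1 - q ^ k) * asc_moment q a n (k - 1)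
        - (asc_moment q a n (Suc k) - (1 + a) * asc_moment q a n k) / a) / q ^ k"
proof -
  let ?h = "rogers_szego q a"
  let ?c = "asc_coeff q a n"
  have "?c l * ((1 - q ^ l) * ?h (k + l - 1))
    = (- (1 - q ^ k) * (?c l * ?h (l + (k - 1)))
        - (?c l * ?h (l + Suc k) - (1 + a) * (?c l * ?h (l + k))) / a) / q ^ k" for l
  proof -
    have rec: "?h (l + Suc k) = (1 + a) * ?h (l + k) - a * (1 - q ^ (l + k)) * ?h (k + l - 1)"
      using rogers_szego_recurrence[OF q_not_root, of a "k + l"] by (simp add: add.commute)
    have e: "(1 - q ^ k) * ?h (l + (k - 1)) = (1 - q ^ k) * ?h (k + l - 1)"
      by (cases k) (auto simp: add.commute)
    have "(- (1 - q ^ k) * (?c l * ?h (l + (k - 1)))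
        - (?c l * ?h (l + Suc k) - (1 + a) * (?c l * ?h (l + k))) / a) / q ^ k
      = ?c l * (- ((1 - q ^ k) * ?h (l + (k - 1)))
        - (?h (l + Suc k) - (1 + a) * ?h (l + k)) / a) / q ^ k"
      using assms q_nonzero by (simp add: field_simps)
    \<comment> \<open>The recurrence reduces the bracket to
      \<open>(1 - q ^ (l + k)) - (1 - q ^ k)\<close>, which is
      \<open>q ^ k * (1 - q ^ l)\<close>.\<close>
    also have "\<dots> = ?c l * (- ((1 - q ^ k) * ?h (k + l - 1)) + (1 - q ^ (l + k)) * ?h (k + l - 1)) / q ^ k"
      unfolding e rec using assms by simp
    also have "\<dots> = ?c l * ((1 - q ^ l) * ?h (k + l - 1))"
      using q_nonzero by (simp add: field_simps power_add)
    finally show ?thesis ..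
  qed
  then show ?thesis
    unfolding asc_moment_lessThan[OF assms(1)]
    by (simp only: sum_divide_distrib sum_subtractf sum_distrib_left flip: sum_divide_distrib)
qed

text \<open>The double sum is \<open>L (U_m D U_n)\<close>. For \<open>n \<le> Suc m\<close>,
  \<open>D U_n\<close> has degree at most \<open>m\<close>, so orthogonality to \<open>U_m\<close>
  leaves only a possible \<open>x^m\<close> term. Otherwise the adjoint moves to \<open>U_m\<close>,
  where \<open>R U_m\<close> has degree at most \<open>m + 1 < n\<close>.\<close>

lemma asc_lowering_pairing:
  assumes "m < M" "n < M" and "a \<noteq> 0"
  shows "(\<Sum>k<M. \<Sum>l<M. asc_coeff q a m k * asc_coeff q a n l
            * ((1 - q ^ l) * rogers_szego q a (k + l - 1)))
    = (if n = Suc m then (1 - q ^ n) * asc_moment q a m m else 0)" (is "?E = _")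
proof (cases "n \<le> Suc m")
  case True
  have "?E = (\<Sum>l<M. asc_coeff q a n l * ((1 - q ^ l) * asc_moment q a m (l - 1)))"
    unfolding asc_moment_lessThan[OF assms(1)] sum_distrib_left
  proof (subst sum.swap, intro sum.cong refl)
    fix l k
    show "asc_coeff q a m k * asc_coeff q a n l * ((1 - q ^ l) * rogers_szego q a (k + l - 1))
      = asc_coeff q a n l * ((1 - q ^ l) * (asc_coeff q a m k * rogers_szego q a (k + (l - 1))))"
      by (cases l) (auto simp: mult_ac)
  qed
  also have "\<dots> = (\<Sum>l<M. if l = Suc m then asc_coeff q a n l * ((1 - q ^ l) * asc_moment q a m m) else 0)"
  proof (intro sum.cong refl)
    fix l
    consider "l = 0" | "l = Suc m" | "l > Suc m" | "l > 0" "l - 1 < m"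
      by linarith
    then show "asc_coeff q a n l * ((1 - q ^ l) * asc_moment q a m (l - 1))
      = (if l = Suc m then asc_coeff q a n l * ((1 - q ^ l) * asc_moment q a m m) else 0)"
    proof cases
      case 3
      then show ?thesis using True by (simp add: asc_coeff_above)
    qed (auto simp: asc_moment_below)
  qed
  also have "\<dots> = (if n = Suc m then (1 - q ^ n) * asc_moment q a m m else 0)"
    using assms True q_nonzero by (auto simp: asc_coeff_diag asc_coeff_above le_Suc_eq)
  finally show ?thesis .
next
  case False
  have "asc_coeff q a m k * (\<Sum>l<M. asc_coeff q a n l * ((1 - q ^ l) * rogers_szego q a (k + l - 1))) = 0" for k
  proof (cases "k \<le> m")
    case True
    then show ?thesis
      unfolding asc_lowering_adjoint[OF assms(2,3)] using False by (simp add: asc_moment_below)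
  qed (simp add: asc_coeff_above)
  then have "?E = 0"
    by (simp add: sum_distrib_left mult.assoc)
  with False show ?thesis by simp
qed

text \<open>Writing \<open>q ^ k - q ^ l\<close> as \<open>(1 - q ^ l) - (1 - q ^ k)\<close> splits
  the skew form into two pairings, with \<open>D\<close> acting on one argument in each.\<close>

lemma asc_skew_pairing:
  assumes "m < M" "n < M" and "a \<noteq> 0"
  shows "(\<Sum>k<M. \<Sum>l<M. asc_coeff q a m k * ((q ^ k - q ^ l) * rogers_szego q a (k + l - 1))
            * asc_coeff q a n l)
    = (if n = Suc m then (1 - q ^ n) * asc_moment q a m m else 0)
      - (if m = Suc n then (1 - q ^ m) * asc_moment q a n n else 0)"
proof -
  let ?F = "\<lambda>m n k l. asc_coeff q a m k * asc_coeff q a n l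
            * ((1 - q ^ l) * rogers_szego q a (k + l - 1))"
  have "(\<Sum>k<M. \<Sum>l<M. asc_coeff q a m k * ((q ^ k - q ^ l) * rogers_szego q a (k + l - 1))
            * asc_coeff q a n l)
    = (\<Sum>k<M. \<Sum>l<M. ?F m n k l) - (\<Sum>k<M. \<Sum>l<M. ?F n m l k)"
    unfolding sum_subtractf[symmetric]
    by (intro sum.cong refl) (simp add: algebra_simps)
  also have "(\<Sum>k<M. \<Sum>l<M. ?F n m l k) = (\<Sum>l<M. \<Sum>k<M. ?F n m l k)"
    by (rule sum.swap)
  finally show ?thesis
    by (simp only: asc_lowering_pairing[OF assms] asc_lowering_pairing[OF assms(2,1,3)])
qed

end

section \<open>The Pfaffian\<close>

lemma pfaffian_cong:
  assumes "\<And>i j. i < 2*N \<Longrightarrow> j < 2*N \<Longrightarrow> A i j = B i j"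
  shows "pfaffian N A = pfaffian N B"
proof -
  have "(\<Prod>l<N. A (p (2*l)) (p (2*l+1))) = (\<Prod>l<N. B (p (2*l)) (p (2*l+1)))"
    if "p permutes {..<2*N}" for p
    using permutes_in_image[OF that] by (intro prod.cong assms) auto
  then show ?thesis
    unfolding pfaffian_def by simp
qed

lemma pfaffian_rogers_szego:
  fixes q a :: "'a::field_char_0"
  assumes q: "\<And>n. n > 0 \<Longrightarrow> q ^ n \<noteq> 1" "q \<noteq> 0" and a: "a \<noteq> 0"
  shows "pfaffian N (\<lambda>i j. (q ^ i - q ^ j) * rogers_szego q a (i + j - 1))
    = (\<Prod>k<N. (1 - q ^ (2*k+1)) * asc_moment q a (2*k) (2*k))"
proof -
  let ?A = "\<lambda>i j. (q ^ i - q ^ j) * rogers_szego q a (i + j - 1)"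
  let ?B = "asc_coeff q a"
  \<comment> \<open>The Gram matrix of the skew form in the basis \<open>U_n\<close>.\<close>
  define T where "T = (\<lambda>m n. (if n = Suc m then (1 - q ^ n) * asc_moment q a m m else 0)
      - (if m = Suc n then (1 - q ^ m) * asc_moment q a n n else 0))"
  have "pfaffian N ?A = pfaffian N (\<lambda>i j. \<Sum>k<2*N. \<Sum>l<2*N. ?B i k * ?A k l * ?B j l)"
    using leibniz_sum_lower_unitriangular[of ?B "2*N"] q(2)
    by (simp add: pfaffian_congruence asc_coeff_diag asc_coeff_above)
  also have "\<dots> = pfaffian N T"
    by (intro pfaffian_cong) (simp only: asc_skew_pairing[OF q _ _ a] T_def)
  also have "\<dots> = (\<Prod>k<N. T (2*k) (2*k+1))"
    by (rule pfaffian_skew_tridiagonal) (simp_all add: T_def)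
  finally show ?thesis
    by (simp add: T_def)
qed

text \<open>The factor \<open>1 - q ^ (2*k+1)\<close> completes \<open>qpoch q q (2*k)\<close> to
  \<open>qpoch q q (2*k+1)\<close>; the exponents of \<open>q\<close> are
  \<open>k * (2*k - 1)\<close>, whose sum over \<open>k < N\<close> is N(N-1)(4N-5)/6.\<close>

lemma prod_asc_moment:
  fixes q a :: real
  assumes "0 < q" "q < 1"
  shows "(\<Prod>k<N. (1 - q ^ (2*k+1)) * asc_moment q a (2*k) (2*k))
    = a ^ (N * (N - 1)) * q powr (real N * (real N - 1) * (4 * real N - 5) / 6)
      * (\<Prod>k<N. qpoch q q (2*k+1))"
proof (induction N)
  case (Suc N)
  have q: "q ^ n \<noteq> 1" if "n > 0" for n
    using assms that by (metis less_irrefl power_Suc_less_one Suc_pred)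
  have mom: "asc_moment q a (2*N) (2*N) = a ^ (2*N) * q ^ (N * (2*N - 1)) * qpoch q q (2*N)"
    using asc_moment_diag[OF q, of a "2*N"] assms by simp
  \<comment> \<open>At \<open>N = 0\<close> the truncated \<open>2*N - 1\<close> is multiplied by
    zero.\<close>
  have "real (N * (2*N - 1)) = real N * (2 * real N - 1)"
    by (cases N) (auto simp: algebra_simps)
  then have "q ^ (N * (2*N - 1)) = q powr (real N * (2 * real N - 1))"
    by (simp only: powr_realpow[OF assms(1), symmetric])
  then have "q powr (real N * (real N - 1) * (4 * real N - 5) / 6) * q ^ (N * (2*N - 1))
      = q powr (real N * (real N - 1) * (4 * real N - 5) / 6 + real N * (2 * real N - 1))"
    by (simp add: powr_add)
  also have "real N * (real N - 1) * (4 * real N - 5) / 6 + real N * (2 * real N - 1)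
      = real (Suc N) * (real (Suc N) - 1) * (4 * real (Suc N) - 5) / 6"
    by (simp add: field_simps)
  finally have qp: "q powr (real (Suc N) * (real (Suc N) - 1) * (4 * real (Suc N) - 5) / 6)
      = q powr (real N * (real N - 1) * (4 * real N - 5) / 6) * q ^ (N * (2*N - 1))" ..
  have "Suc N * (Suc N - 1) = N * (N - 1) + 2*N"
    by (cases N) auto
  then have ap: "a ^ (Suc N * (Suc N - 1)) = a ^ (N * (N - 1)) * a ^ (2*N)"
    by (simp only: power_add)
  show ?case
    unfolding qp ap prod.lessThan_Suc Suc.IH mom
    by (simp add: qpoch_Suc mult_ac)
qed (use assms in simp)

theorem mainTheorem2:
  fixes q a :: real and N :: nat
  assumes "0 < q" and "q < 1" and "a < 0" and "N \<ge> 1"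
  shows "pfaffian N (\<lambda>i j. (q ^ i - q ^ j) * (\<Sum>k=0..i+j-1. qbinom q (i+j-1) k * a ^ k))
    = a ^ (N * (N - 1))
      * q powr (real N * (real N - 1) * (4 * real N - 5) / 6)
      * (\<Prod>k=0..N-1. qpoch q q (2*k+1))"
proof -
  have q: "q ^ n \<noteq> 1" if "n > 0" for n
    using assms(1,2) that by (metis less_irrefl power_Suc_less_one Suc_pred)
  have "pfaffian N (\<lambda>i j. (q ^ i - q ^ j) * (\<Sum>k=0..i+j-1. qbinom q (i+j-1) k * a ^ k))
      = (\<Prod>k<N. (1 - q ^ (2*k+1)) * asc_moment q a (2*k) (2*k))"
    using pfaffian_rogers_szego[OF q] assms by (simp add: rogers_szego_def)
  moreover have "{0..N-1} = {..<N}"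
    using assms(4) by auto
  ultimately show ?thesis
    using assms(1,2) by (simp only: prod_asc_moment)
qed

end
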